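(* For every fixed $d\geq 2$ there is a constant $C_d$ such that every $N\times N$ sign matrix of VC dimension $d$ has sign rank at most $C_d N^{1-1/d}$; that is, $f(N,d)\leq O(N^{1-1/d})$, where $f(N,d)$ is the maximum sign rank of an $N\times N$ sign matrix with VC dimension $d$.
   Context: A sign matrix has entries in $\{\pm1\}$. Its sign rank is $\min\{\text{rank}(M): \text{sign}(M)=S\}$ over real matrices $M$ with no zero entries, $\text{sign}$ entrywise, rank over $\mathbb R$. A set $C$ of columns is shattered if every pattern in $\{\pm1\}^C$ appears as a row of the restriction of $S$ to $C$; the VC dimension is the maximum size of a shattered set of columns. *)

theory Defs
  imports "Jordan_Normal_Form.DL_Rank" "HOL-Library.Landau_Symbols" "HOL-Library.FuncSet"
begin

definition sign_matrix :: "real mat \<Rightarrow> bool" where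
  "sign_matrix S \<longleftrightarrow> (\<forall>i<dim_row S. \<forall>j<dim_col S. S $$ (i, j) \<in> {-1, 1})"

definition sign_rank :: "real mat \<Rightarrow> nat" where
  "sign_rank S = (LEAST r. \<exists>M \<in> carrier_mat (dim_row S) (dim_col S).
     (\<forall>i<dim_row S. \<forall>j<dim_col S. M $$ (i, j) \<noteq> 0) \<and>
     map_mat sgn M = S \<and> vec_space.rank (dim_row S) M = r)"

definition shattered :: "real mat \<Rightarrow> nat set \<Rightarrow> bool" where
  "shattered S C \<longleftrightarrow> C \<subseteq> {..<dim_col S} \<and>
     (\<forall>p \<in> C \<rightarrow> {-1, 1}. \<exists>i<dim_row S. \<forall>j\<in>C. S $$ (i, j) = p j)"

text \<open>On \<^typ>\<open>nat\<close>, \<^const>\<open>Sup\<close> is the maximum of a finite nonempty set, and \<open>0\<close> for the empty set.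
  The empty set occurs below only for matrices without rows, respectively when no matrix of the
  given size has VC dimension \<open>d\<close>.\<close>

definition VC_dim :: "real mat \<Rightarrow> nat" where
  "VC_dim S = Sup {card C | C. shattered S C}"

definition max_sign_rank :: "nat \<Rightarrow> nat \<Rightarrow> nat" where
  "max_sign_rank N d =
     Sup {sign_rank S | S. S \<in> carrier_mat N N \<and> sign_matrix S \<and> VC_dim S = d}"

end

theory Submission
  imports Defs
begin

text \<open>
  If the rows of a sign matrix can be listed so that every column changes sign at most \<open>t\<close> times,
  then each column is the sign pattern of a polynomial of degree at most \<open>t\<close> evaluated at the
  positions of the rows, so the sign rank is at most \<open>t + 1\<close>. Welzl's reweighting argument produces
  such a list with \<open>t = O(N\<^bsup>1-1/d\<^esup>)\<close>, provided that any \<open>n\<close> rows contain two that are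
  separated by an \<open>O(n\<^bsup>-1/d\<^esup>)\<close> fraction of the weight of the columns. The latter is Haussler's
  packing lemma. Its proof samples \<open>s\<close> columns independently and counts, with weights, the pairs of
  row patterns on the sample that differ in one position: the one-inclusion graph of a family of
  VC dimension \<open>d\<close> is sparse, while many pairwise separated rows force many such pairs.
\<close>

section \<open>Shattering and the one-inclusion graph\<close>

definition shatters :: "'a set set \<Rightarrow> 'a set \<Rightarrow> bool" where
  "shatters F C \<longleftrightarrow> (\<forall>B\<subseteq>C. \<exists>A\<in>F. A \<inter> C = B)"

lemma shatters_empty_iff: "shatters F {} \<longleftrightarrow> F \<noteq> {}"
  unfolding shatters_def by auto

text \<open>\<open>x\<close> lies outside \<open>C\<close>, so passing from \<open>A\<close> to
  \<open>insert x A\<close> leaves the trace on \<open>C\<close> unchanged.\<close>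

lemma shatters_projection:
  assumes "shatters {A. A \<subseteq> U \<and> (A \<in> F \<or> insert x A \<in> F)} C" "C \<subseteq> U" "x \<notin> U"
  shows "shatters F C"
  unfolding shatters_def
proof (intro allI impI)
  fix B assume "B \<subseteq> C"
  then obtain A where A: "A \<subseteq> U" "A \<in> F \<or> insert x A \<in> F" "A \<inter> C = B"
    using assms(1) unfolding shatters_def by blast
  have "insert x A \<inter> C = B" using A assms by auto
  then show "\<exists>A\<in>F. A \<inter> C = B" using A by blast
qed

text \<open>Once the trace of \<open>A\<close> on \<open>C\<close> is right, membership of
  \<open>x\<close> can still be chosen freely. This lowers the VC dimension by one in the inductions
  below.\<close>

lemma shatters_insert:
  assumes "shatters {A. A \<subseteq> U \<and> A \<in> F \<and> insert x A \<in> F} C" "C \<subseteq> U" "x \<notin> U"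
  shows "shatters F (insert x C)"
  unfolding shatters_def
proof (intro allI impI)
  fix B assume B: "B \<subseteq> insert x C"
  then have "B - {x} \<subseteq> C" by blast
  then obtain A where A: "A \<subseteq> U" "A \<in> F" "insert x A \<in> F" "A \<inter> C = B - {x}"
    using assms(1) unfolding shatters_def by blast
  show "\<exists>A\<in>F. A \<inter> insert x C = B"
  proof (cases "x \<in> B")
    case True
    then have "insert x A \<inter> insert x C = B" using A B assms by auto
    then show ?thesis using A by blast
  next
    case False
    then have "A \<inter> insert x C = B" using A B assms by auto
    then show ?thesis using A by blast
  qed
qed

lemma sum_Pow_insert:
  fixes f :: "'a set \<Rightarrow> 'b::comm_monoid_add"
  assumes "finite V" "x \<notin> V"
  shows "(\<Sum>A\<in>Pow (insert x V). f A) = (\<Sum>A\<in>Pow V. f A + f (insert x A))"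
proof -
  have "inj_on (insert x) (Pow V)"
  proof (rule inj_onI)
    fix A B assume "A \<in> Pow V" "B \<in> Pow V" "insert x A = insert x B"
    then show "A = B" using assms(2) insert_ident[of x A B] by blast
  qed
  moreover have "Pow V \<inter> insert x ` Pow V = {}" using assms by auto
  ultimately show ?thesis
    using assms(1) by (simp add: Pow_insert sum.union_disjoint sum.reindex sum.distrib)
qed

text \<open>Delete \<open>x\<close>: \<open>F0\<close> is the projection of \<open>F\<close>, and
  \<open>F1\<close> collects the sets that the projection hits twice, with VC dimension one less.
  With \<open>m = card U\<close> the step is
  \<open>(m + 1)^d + (m + 1)^(d - 1) \<le> (m + 2)^d\<close>.\<close>

lemma Sauer_Shelah:
  assumes "finite U" "F \<subseteq> Pow U" "\<And>C. C \<subseteq> U \<Longrightarrow> shatters F C \<Longrightarrow> card C \<le> d"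
  shows "card F \<le> (card U + 1) ^ d"
  using assms
proof (induction U arbitrary: F d rule: finite_induct)
  case empty
  then have "F \<subseteq> {{}}" by simp
  then have "card F \<le> card {{}::'a set}" by (intro card_mono) auto
  then show ?case by simp
next
  case (insert x U)
  define F0 where "F0 = {A. A \<subseteq> U \<and> (A \<in> F \<or> insert x A \<in> F)}"
  define F1 where "F1 = {A. A \<subseteq> U \<and> A \<in> F \<and> insert x A \<in> F}"
  have sub: "F0 \<subseteq> Pow U" "F1 \<subseteq> Pow U" by (auto simp: F0_def F1_def)
  define i :: "'a set set \<Rightarrow> 'a set \<Rightarrow> nat" where "i = (\<lambda>G A. if A \<in> G then 1 else 0)"
  have i: "card G = (\<Sum>A\<in>Pow V. i G A)" if "finite V" "G \<subseteq> Pow V" for G V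
    using that by (simp add: i_def sum.If_cases Int_absorb1)
  have "card F = (\<Sum>A\<in>Pow U. i F A + i F (insert x A))"
    using i[of "insert x U" F] insert by (simp add: sum_Pow_insert)
  also have "\<dots> = (\<Sum>A\<in>Pow U. i F0 A + i F1 A)"
    by (rule sum.cong) (auto simp: i_def F0_def F1_def)
  also have "\<dots> = card F0 + card F1"
    using i[of U F0] i[of U F1] insert.hyps sub by (simp add: sum.distrib)
  finally have card: "card F = card F0 + card F1" .
  have 0: "card F0 \<le> (card U + 1) ^ d"
    using insert.prems(2) shatters_projection[of U F x] insert.hyps
    by (intro insert.IH) (auto simp: F0_def)
  have sh: "card C + 1 \<le> d" if "C \<subseteq> U" "shatters F1 C" for C
  proof -
    have "card (insert x C) \<le> d"
      using shatters_insert[of U F x C] that insert.hyps insert.prems(2)[of "insert x C"]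
      by (auto simp: F1_def)
    moreover have "x \<notin> C" "finite C" using that insert.hyps finite_subset by auto
    ultimately show ?thesis by simp
  qed
  show ?case
  proof (cases d)
    case 0
    then have "F1 = {}" using sh[of "{}"] by (auto simp: shatters_empty_iff)
    then show ?thesis using card \<open>card F0 \<le> _\<close> 0 by simp
  next
    case (Suc e)
    have "card F1 \<le> (card U + 1) ^ e"
      using sh Suc by (intro insert.IH) (auto simp: F1_def)
    then have "card F \<le> (card U + 1) ^ e * (card U + 2)"
      using card 0 Suc by (simp add: algebra_simps)
    also have "\<dots> \<le> (card U + 2) ^ e * (card U + 2)"
      by (intro mult_right_mono power_mono) auto
    finally show ?thesis using insert.hyps Suc by (simp add: algebra_simps)
  qed
qed

text \<open>Splitting \<open>w\<close> along \<open>x\<close> into the maximum and the minimum of \<open>w A\<close> and \<open>w (insert x A)\<close> keeps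
  the total weight, does not decrease the edge weight in the other directions, and lowers the VC
  dimension of the support of the minimum.\<close>

lemma weighted_edge_bound:
  fixes w :: "'a set \<Rightarrow> nat"
  assumes "finite U" "\<And>C. C \<subseteq> U \<Longrightarrow> shatters {A. A \<subseteq> U \<and> w A > 0} C \<Longrightarrow> card C < D"
  shows "(\<Sum>x\<in>U. \<Sum>A\<in>Pow (U - {x}). min (w A) (w (insert x A))) \<le> D * (\<Sum>A\<in>Pow U. w A)"
  using assms
proof (induction U arbitrary: w D rule: finite_induct)
  case empty
  then show ?case by simp
next
  case (insert x U)
  define w0 where "w0 A = max (w A) (w (insert x A))" for A
  define w1 where "w1 A = min (w A) (w (insert x A))" for A
  let ?F = "{A. A \<subseteq> insert x U \<and> w A > 0}"
  have F0: "{A. A \<subseteq> U \<and> w0 A > 0} = {A. A \<subseteq> U \<and> (A \<in> ?F \<or> insert x A \<in> ?F)}"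
    by (auto simp: w0_def)
  have F1: "{A. A \<subseteq> U \<and> w1 A > 0} = {A. A \<subseteq> U \<and> A \<in> ?F \<and> insert x A \<in> ?F}"
    by (auto simp: w1_def)
  have 0: "(\<Sum>y\<in>U. \<Sum>A\<in>Pow (U - {y}). min (w0 A) (w0 (insert y A))) \<le> D * (\<Sum>A\<in>Pow U. w0 A)"
  proof (rule insert.IH)
    fix C assume "C \<subseteq> U" "shatters {A. A \<subseteq> U \<and> w0 A > 0} C"
    then show "card C < D"
      using shatters_projection[of U ?F x C] insert.hyps insert.prems[of C] unfolding F0 by auto
  qed
  have sh: "card C + 1 < D" if "C \<subseteq> U" "shatters {A. A \<subseteq> U \<and> w1 A > 0} C" for C
  proof -
    have "card (insert x C) < D"
      using shatters_insert[of U ?F x C] that insert.hyps insert.prems[of "insert x C"]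
      unfolding F1 by auto
    moreover have "x \<notin> C" "finite C" using that insert.hyps finite_subset by auto
    ultimately show ?thesis by simp
  qed
  \<comment> \<open>The support of \<open>w1\<close> obeys the bound with \<open>D - 1\<close>; the
    spare copy of its total weight pays for the edges in direction \<open>x\<close>. If
    \<open>w1\<close> vanishes on \<open>Pow U\<close>, then \<open>D\<close> may be
    \<open>0\<close>, but both sides are \<open>0\<close>.\<close>
  have 1: "(\<Sum>y\<in>U. \<Sum>A\<in>Pow (U - {y}). min (w1 A) (w1 (insert y A))) + (\<Sum>A\<in>Pow U. w1 A)
      \<le> D * (\<Sum>A\<in>Pow U. w1 A)"
  proof (cases "\<exists>A\<subseteq>U. w1 A > 0")
    case True
    then have "D > 0" using sh[of "{}"] by (auto simp: shatters_empty_iff)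
    have "(\<Sum>y\<in>U. \<Sum>A\<in>Pow (U - {y}). min (w1 A) (w1 (insert y A)))
      \<le> (D - 1) * (\<Sum>A\<in>Pow U. w1 A)"
      using sh by (intro insert.IH) (simp add: less_diff_conv)
    then show ?thesis using \<open>D > 0\<close> by (cases D) auto
  next
    case False
    then have 0: "w1 A = 0" if "A \<subseteq> U" for A using that by (metis gr0I)
    have "(\<Sum>y\<in>U. \<Sum>A\<in>Pow (U - {y}). min (w1 A) (w1 (insert y A))) = 0"
    proof (intro sum.neutral ballI)
      fix y A assume "A \<in> Pow (U - {y})"
      then have "w1 A = 0" by (intro 0) auto
      then show "min (w1 A) (w1 (insert y A)) = 0" by simp
    qed
    moreover have "(\<Sum>A\<in>Pow U. w1 A) = 0" using 0 by (intro sum.neutral) auto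
    ultimately show ?thesis by simp
  qed
  have "(\<Sum>y\<in>insert x U. \<Sum>A\<in>Pow (insert x U - {y}). min (w A) (w (insert y A)))
      = (\<Sum>A\<in>Pow U. w1 A) +
        (\<Sum>y\<in>U. \<Sum>A\<in>Pow (insert x (U - {y})). min (w A) (w (insert y A)))"
  proof -
    have "insert x U - {x} = U" using insert.hyps by auto
    moreover have "insert x U - {y} = insert x (U - {y})" if "y \<in> U" for y
      using that insert.hyps by auto
    ultimately show ?thesis using insert.hyps by (simp add: w1_def)
  qed
  also have "(\<Sum>y\<in>U. \<Sum>A\<in>Pow (insert x (U - {y})). min (w A) (w (insert y A)))
      = (\<Sum>y\<in>U. \<Sum>A\<in>Pow (U - {y}). min (w A) (w (insert y A)) +
            min (w (insert x A)) (w (insert y (insert x A))))"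
    using insert.hyps by (intro sum.cong refl sum_Pow_insert) auto
  \<comment> \<open>With \<open>a\<close>, \<open>b\<close> the weights at \<open>A\<close>,
    \<open>insert y A\<close> and \<open>a'\<close>, \<open>b'\<close> those after adding
    \<open>x\<close>, this is \<open>min a b + min a' b' \<le> min (max a a') (max b b') + min (min
    a a') (min b b')\<close>.\<close>
  also have "\<dots> \<le> (\<Sum>y\<in>U. \<Sum>A\<in>Pow (U - {y}). min (w0 A) (w0 (insert y A)) +
            min (w1 A) (w1 (insert y A)))"
    unfolding w0_def w1_def by (intro sum_mono) (auto simp: insert_commute)
  also have "(\<Sum>A\<in>Pow U. w1 A) + \<dots> \<le> D * (\<Sum>A\<in>Pow U. w0 A) + D * (\<Sum>A\<in>Pow U. w1 A)"
    using 0 1 by (simp add: sum.distrib)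
  also have "\<dots> = D * (\<Sum>A\<in>Pow U. w0 A + w1 A)"
    by (simp add: sum.distrib distrib_left)
  also have "(\<Sum>A\<in>Pow U. w0 A + w1 A) = (\<Sum>A\<in>Pow (insert x U). w A)"
    unfolding sum_Pow_insert[OF insert.hyps] by (rule sum.cong) (auto simp: w0_def w1_def)
  finally show ?case by simp
qed

section \<open>Haussler's packing lemma\<close>

text \<open>A set of sample indices rather than of columns, because the sample \<open>a\<close> may
  draw the same column more than once.\<close>

definition pattern :: "('r \<Rightarrow> 'c \<Rightarrow> bool) \<Rightarrow> 'i set \<Rightarrow> ('i \<Rightarrow> 'c) \<Rightarrow> 'r \<Rightarrow> 'i set" where
  "pattern T J a r = {i \<in> J. T r (a i)}"

definition vc_le :: "('r \<Rightarrow> 'c \<Rightarrow> bool) \<Rightarrow> 'r set \<Rightarrow> 'c set \<Rightarrow> nat \<Rightarrow> bool" where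
  "vc_le T R X d \<longleftrightarrow> (\<forall>C\<subseteq>X. (\<forall>B\<subseteq>C. \<exists>r\<in>R. {c \<in> C. T r c} = B) \<longrightarrow> card C \<le> d)"

lemma vc_le_subset: "vc_le T R X d \<Longrightarrow> Q \<subseteq> R \<Longrightarrow> vc_le T Q X d"
  unfolding vc_le_def by (meson subsetD)

text \<open>Indices with the same column lie in the same patterns, so \<open>a\<close> is injective
  on a shattered index set and carries it to a shattered column set of equal size.\<close>

lemma card_shattered_patterns_le:
  assumes vc: "vc_le T R X d" and a: "a \<in> J \<rightarrow> X" and "C \<subseteq> J"
    and sh: "shatters (pattern T J a ` R) C"
  shows "card C \<le> d"
proof -
  have ex: "\<exists>r\<in>R. \<forall>i\<in>C. T r (a i) \<longleftrightarrow> i \<in> B" if "B \<subseteq> C" for B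
  proof -
    obtain r where "r \<in> R" "pattern T J a r \<inter> C = B"
      using sh \<open>B \<subseteq> C\<close> unfolding shatters_def by auto
    then show ?thesis using \<open>C \<subseteq> J\<close> by (intro bexI[of _ r]) (auto simp: pattern_def)
  qed
  have inj: "inj_on a C"
  proof (rule inj_onI, rule ccontr)
    fix i j assume ij: "i \<in> C" "j \<in> C" "a i = a j" "i \<noteq> j"
    obtain r where "\<forall>k\<in>C. T r (a k) \<longleftrightarrow> k \<in> {i}" using ex[of "{i}"] ij by auto
    then show False using ij by (metis singletonD singletonI)
  qed
  have "card (a ` C) \<le> d"
  proof -
    have "\<exists>r\<in>R. {c \<in> a ` C. T r c} = B" if "B \<subseteq> a ` C" for B
    proof -
      obtain r where "r \<in> R" "\<forall>i\<in>C. T r (a i) \<longleftrightarrow> i \<in> {i\<in>C. a i \<in> B}"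
        using ex[of "{i\<in>C. a i \<in> B}"] by auto
      then show ?thesis using that by (intro bexI[of _ r]) auto
    qed
    moreover have "a ` C \<subseteq> X" using a \<open>C \<subseteq> J\<close> by auto
    ultimately show ?thesis using vc unfolding vc_le_def by blast
  qed
  then show ?thesis using inj by (simp add: card_image)
qed

text \<open>A column with \<open>p\<close> true and \<open>q\<close> false rows in \<open>K\<close>
  separates \<open>2 * p * q\<close> ordered pairs, and \<open>p * q \<le> card K * min q p\<close>.
  Summing the separation over all ordered pairs gives at least
  \<open>\<delta> * card K * (card K - 1)\<close>; divide by \<open>2 * card K\<close>. The
  \<open>of_bool\<close> makes the left side \<open>0\<close> for empty \<open>K\<close>.\<close>

lemma separated_cluster_bound:
  fixes \<mu> :: "'c \<Rightarrow> real"
  assumes "finite K" "finite X" and \<mu>: "\<And>c. c \<in> X \<Longrightarrow> \<mu> c \<ge> 0" and "\<delta> \<ge> 0"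
    and sep: "\<And>x y. x \<in> K \<Longrightarrow> y \<in> K \<Longrightarrow> x \<noteq> y \<Longrightarrow> (\<Sum>c\<in>{c\<in>X. T x c \<noteq> T y c}. \<mu> c) \<ge> \<delta>"
  shows "\<delta> / 2 * (real (card K) - of_bool (K \<noteq> {}))
    \<le> (\<Sum>c\<in>X. \<mu> c * min (real (card {r\<in>K. \<not> T r c})) (real (card {r\<in>K. T r c})))"
proof (cases "K = {}")
  case True
  then show ?thesis by simp
next
  case False
  define b where "b = real (card K)"
  have "b > 0" using False assms(1) by (simp add: b_def card_gt_0_iff)
  define p where "p c = real (card {r\<in>K. T r c})" for c
  define q where "q c = real (card {r\<in>K. \<not> T r c})" for c
  have p: "p c = (\<Sum>x\<in>K. of_bool (T x c))" for c
    using assms(1) by (simp add: p_def of_bool_def sum.If_cases Int_def)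
  have q: "q c = (\<Sum>x\<in>K. of_bool (\<not> T x c))" for c
    using assms(1) by (simp add: q_def of_bool_def sum.If_cases Int_def)
  have pq: "p c + q c = b" for c
  proof -
    have "p c + q c = (\<Sum>x\<in>K. 1)" unfolding p q sum.distrib[symmetric]
      by (rule sum.cong) auto
    then show ?thesis by (simp add: b_def)
  qed
  have "2 * p c * q c = (\<Sum>x\<in>K. \<Sum>y\<in>K. of_bool (T x c \<noteq> T y c))" for c
  proof -
    have "2 * p c * q c = p c * q c + q c * p c" by simp
    also have "\<dots> = (\<Sum>x\<in>K. \<Sum>y\<in>K. of_bool (T x c) * of_bool (\<not> T y c) +
        of_bool (\<not> T x c) * of_bool (T y c))"
      unfolding p q sum_product by (simp add: sum.distrib)
    also have "\<dots> = (\<Sum>x\<in>K. \<Sum>y\<in>K. of_bool (T x c \<noteq> T y c))"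
      by (intro sum.cong refl) auto
    finally show ?thesis .
  qed
  then have "(\<Sum>c\<in>X. \<mu> c * (2 * p c * q c))
      = (\<Sum>c\<in>X. \<Sum>x\<in>K. \<Sum>y\<in>K. \<mu> c * of_bool (T x c \<noteq> T y c))"
    by (simp add: sum_distrib_left)
  also have "\<dots> = (\<Sum>x\<in>K. \<Sum>y\<in>K. \<Sum>c\<in>X. \<mu> c * of_bool (T x c \<noteq> T y c))"
    by (subst sum.swap, intro sum.cong refl, rule sum.swap)
  also have "\<dots> \<ge> (\<Sum>x\<in>K. \<Sum>y\<in>K. \<delta> * of_bool (x \<noteq> y))"
  proof (intro sum_mono)
    fix x y assume "x \<in> K" "y \<in> K"
    have "(\<Sum>c\<in>X. \<mu> c * of_bool (T x c \<noteq> T y c)) = (\<Sum>c\<in>{c\<in>X. T x c \<noteq> T y c}. \<mu> c)"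
      using assms(2) by (simp add: of_bool_def if_distrib sum.If_cases Int_def cong: if_cong)
    then show "\<delta> * of_bool (x \<noteq> y) \<le> (\<Sum>c\<in>X. \<mu> c * of_bool (T x c \<noteq> T y c))"
      using sep[OF \<open>x \<in> K\<close> \<open>y \<in> K\<close>] by (auto simp: of_bool_def)
  qed
  also have "(\<Sum>x\<in>K. \<Sum>y\<in>K. \<delta> * of_bool (x \<noteq> y)) = (\<Sum>x\<in>K. \<delta> * (b - 1))"
  proof (rule sum.cong)
    fix x assume "x \<in> K"
    have "(\<Sum>y\<in>K. \<delta> * of_bool (x \<noteq> y)) = \<delta> * real (card (K - {x}))"
    proof -
      have "K \<inter> {y. x \<noteq> y} = K - {x}" by auto
      then show ?thesis
        using assms(1) by (simp add: of_bool_def if_distrib sum.If_cases cong: if_cong)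
    qed
    also have "real (card (K - {x})) = b - 1"
      using \<open>x \<in> K\<close> assms(1) False by (simp add: b_def card_gt_0_iff of_nat_diff Suc_leI)
    finally show "(\<Sum>y\<in>K. \<delta> * of_bool (x \<noteq> y)) = \<delta> * (b - 1)" .
  qed simp
  also have "\<dots> = b * (\<delta> * (b - 1))" by (simp add: b_def)
  finally have 1: "b * (\<delta> * (b - 1)) \<le> (\<Sum>c\<in>X. \<mu> c * (2 * p c * q c))" .
  have "(\<Sum>c\<in>X. \<mu> c * (2 * p c * q c)) \<le> (\<Sum>c\<in>X. \<mu> c * (2 * b * min (q c) (p c)))"
  proof (intro sum_mono mult_left_mono)
    fix c assume "c \<in> X"
    have "0 \<le> p c" "0 \<le> q c" by (auto simp: p_def q_def)
    then have "p c * q c \<le> (p c + q c) * min (q c) (p c)"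
      by (auto simp: min_def algebra_simps)
    then show "2 * p c * q c \<le> 2 * b * min (q c) (p c)" using pq[of c] by simp
  qed (use \<mu> in auto)
  also have "\<dots> = b * (2 * (\<Sum>c\<in>X. \<mu> c * min (q c) (p c)))"
    by (simp add: sum_distrib_left mult_ac)
  finally have "b * (\<delta> * (b - 1)) \<le> b * (2 * (\<Sum>c\<in>X. \<mu> c * min (q c) (p c)))"
    using 1 by linarith
  then have "\<delta> * (b - 1) \<le> 2 * (\<Sum>c\<in>X. \<mu> c * min (q c) (p c))"
    using \<open>b > 0\<close> by simp
  then show ?thesis using False by (simp add: b_def p_def q_def)
qed

section \<open>Independent samples of columns\<close>

text \<open>The expectation of \<open>f\<close> under independent samples, one from \<open>\<mu>\<close> for each index in \<open>J\<close>.\<close>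

definition sample_mean :: "('c \<Rightarrow> real) \<Rightarrow> 'c set \<Rightarrow> 'i set \<Rightarrow> (('i \<Rightarrow> 'c) \<Rightarrow> real) \<Rightarrow> real" where
  "sample_mean \<mu> X J f = (\<Sum>a\<in>PiE J (\<lambda>_. X). (\<Prod>i\<in>J. \<mu> (a i)) * f a)"

text \<open>By independence the column at \<open>i\<close> can be drawn last, with the rest of the
  sample held fixed.\<close>

lemma sample_mean_insert:
  assumes "finite J" "i \<notin> J"
  shows "sample_mean \<mu> X (insert i J) f = sample_mean \<mu> X J (\<lambda>a. \<Sum>c\<in>X. \<mu> c * f (a(i := c)))"
proof -
  have "sample_mean \<mu> X (insert i J) f =
      (\<Sum>(c, a)\<in>X \<times> PiE J (\<lambda>_. X). (\<Prod>k\<in>insert i J. \<mu> ((a(i := c)) k)) * f (a(i := c)))"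
    unfolding sample_mean_def PiE_insert_eq
    by (subst sum.reindex) (use inj_combinator[OF assms(2), of "\<lambda>_. X"] in \<open>auto simp: case_prod_unfold\<close>)
  also have "\<dots> = (\<Sum>(c, a)\<in>X \<times> PiE J (\<lambda>_. X). \<mu> c * (\<Prod>k\<in>J. \<mu> (a k)) * f (a(i := c)))"
  proof (intro sum.cong refl, clarify)
    fix c a
    have "(\<Prod>k\<in>J. \<mu> ((a(i := c)) k)) = (\<Prod>k\<in>J. \<mu> (a k))"
      using assms(2) by (intro prod.cong) auto
    then show "(\<Prod>k\<in>insert i J. \<mu> ((a(i := c)) k)) * f (a(i := c))
        = \<mu> c * (\<Prod>k\<in>J. \<mu> (a k)) * f (a(i := c))"
      using assms by simp
  qed
  also have "\<dots> = (\<Sum>c\<in>X. \<Sum>a\<in>PiE J (\<lambda>_. X). \<mu> c * (\<Prod>k\<in>J. \<mu> (a k)) * f (a(i := c)))"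
    by (simp add: sum.cartesian_product)
  also have "\<dots> = sample_mean \<mu> X J (\<lambda>a. \<Sum>c\<in>X. \<mu> c * f (a(i := c)))"
    unfolding sample_mean_def
    by (subst sum.swap) (simp add: sum_distrib_left mult_ac)
  finally show ?thesis .
qed

lemma sample_mean_const:
  assumes "finite J" "finite X" "sum \<mu> X = 1"
  shows "sample_mean \<mu> X J (\<lambda>_. k) = k"
proof -
  have "(\<Sum>a\<in>PiE J (\<lambda>_. X). \<Prod>i\<in>J. \<mu> (a i)) = 1"
    using prod_sum_PiE[of J "\<lambda>_. X" "\<lambda>_. \<mu>"] assms by simp
  then show ?thesis by (simp add: sample_mean_def flip: sum_distrib_right)
qed

lemma sample_mean_mono:
  assumes "\<And>c. c \<in> X \<Longrightarrow> \<mu> c \<ge> 0" "\<And>a. a \<in> J \<rightarrow> X \<Longrightarrow> f a \<le> g a"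
  shows "sample_mean \<mu> X J f \<le> sample_mean \<mu> X J g"
  unfolding sample_mean_def
  using assms by (intro sum_mono mult_left_mono prod_nonneg) (auto simp: PiE_def Pi_def)

lemma sample_mean_sum:
  "sample_mean \<mu> X J (\<lambda>a. \<Sum>i\<in>I. f i a) = (\<Sum>i\<in>I. sample_mean \<mu> X J (f i))"
  unfolding sample_mean_def sum_distrib_left by (rule sum.swap)

text \<open>With the sample on \<open>J\<close> fixed, rows of equal pattern form the classes
  \<open>K A\<close>. Drawing \<open>c\<close> at \<open>i\<close> splits \<open>K A\<close> into
  the two endpoints of the edge from \<open>A\<close> to \<open>insert i A\<close>, so
  \<open>separated_cluster_bound\<close> bounds the mean weight of this edge. Each nonempty class
  costs one row, and \<open>Sauer_Shelah\<close> bounds their number.\<close>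

lemma new_coordinate_bound:
  fixes \<mu> :: "'c \<Rightarrow> real"
  assumes "finite R" "finite X" "finite J" "i \<notin> J"
    and \<mu>: "\<And>c. c \<in> X \<Longrightarrow> \<mu> c \<ge> 0" and "\<delta> \<ge> 0" and vc: "vc_le T R X d" and a: "a \<in> J \<rightarrow> X"
    and sep: "\<And>x y. x \<in> R \<Longrightarrow> y \<in> R \<Longrightarrow> x \<noteq> y \<Longrightarrow> (\<Sum>c\<in>{c\<in>X. T x c \<noteq> T y c}. \<mu> c) \<ge> \<delta>"
  defines "w \<equiv> \<lambda>b A. card {r \<in> R. pattern T (insert i J) b r = A}"
  shows "\<delta> / 2 * (real (card R) - (real (card J) + 1) ^ d)
    \<le> (\<Sum>c\<in>X. \<mu> c * (\<Sum>A\<in>Pow J. real (min (w (a(i := c)) A) (w (a(i := c)) (insert i A)))))"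
proof -
  define K where "K A = {r \<in> R. pattern T J a r = A}" for A
  have finK: "finite (K A)" for A using assms(1) by (simp add: K_def)
  have pat: "pattern T (insert i J) (a(i := c)) r =
      (if T r c then insert i (pattern T J a r) else pattern T J a r)" for r c
    using assms(4) by (auto simp: pattern_def)
  have notin: "i \<notin> pattern T J a r" for r using assms(4) by (auto simp: pattern_def)
  have w0: "w (a(i := c)) A = card {r \<in> K A. \<not> T r c}" if "A \<in> Pow J" for A c
  proof -
    have "i \<notin> A" using that assms(4) by auto
    then have "{r \<in> R. pattern T (insert i J) (a(i := c)) r = A} = {r \<in> K A. \<not> T r c}"
      using notin unfolding pat K_def by auto
    then show ?thesis by (simp add: w_def)
  qed
  have w1: "w (a(i := c)) (insert i A) = card {r \<in> K A. T r c}" if "A \<in> Pow J" for A c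
  proof -
    have "i \<notin> A" using that assms(4) by auto
    then have "{r \<in> R. pattern T (insert i J) (a(i := c)) r = insert i A} = {r \<in> K A. T r c}"
      using notin insert_ident[of i A] unfolding pat K_def by (auto split: if_splits)
    then show ?thesis by (simp add: w_def)
  qed
  have "pattern T J a ` R \<subseteq> Pow J" by (auto simp: pattern_def)
  have "card (pattern T J a ` R) \<le> (card J + 1) ^ d"
    using card_shattered_patterns_le[OF vc a] \<open>finite J\<close> \<open>_ \<subseteq> Pow J\<close> by (intro Sauer_Shelah) auto
  then have classes: "real (card (pattern T J a ` R)) \<le> (real (card J) + 1) ^ d"
    by (metis of_nat_1 of_nat_add of_nat_le_iff of_nat_power)
  have "(\<Sum>A\<in>Pow J. real (card (K A)) - of_bool (K A \<noteq> {}))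
      = real (card R) - real (card (pattern T J a ` R))"
  proof -
    have "card R = card (\<Union>A\<in>Pow J. K A)"
      by (rule arg_cong[where f = card]) (auto simp: K_def pattern_def)
    also have "\<dots> = (\<Sum>A\<in>Pow J. card (K A))"
      using \<open>finite J\<close> finK by (intro card_UN_disjoint) (auto simp: K_def)
    finally have "real (card R) = (\<Sum>A\<in>Pow J. real (card (K A)))" by simp
    moreover have "(\<Sum>A\<in>Pow J. of_bool (K A \<noteq> {})) = real (card (pattern T J a ` R))"
    proof -
      have "Pow J \<inter> {A. K A \<noteq> {}} = pattern T J a ` R"
        by (auto simp: K_def pattern_def)
      then show ?thesis using \<open>finite J\<close> by (simp add: of_bool_def sum.If_cases)
    qed
    ultimately show ?thesis by (simp add: sum_subtractf)
  qed
  then have "\<delta> / 2 * (real (card R) - (real (card J) + 1) ^ d)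
      \<le> \<delta> / 2 * (\<Sum>A\<in>Pow J. real (card (K A)) - of_bool (K A \<noteq> {}))"
    using classes \<open>\<delta> \<ge> 0\<close> by (intro mult_left_mono) auto
  also have "\<dots> = (\<Sum>A\<in>Pow J. \<delta> / 2 * (real (card (K A)) - of_bool (K A \<noteq> {})))"
    by (rule sum_distrib_left)
  also have "\<dots> \<le> (\<Sum>A\<in>Pow J. \<Sum>c\<in>X. \<mu> c * min (real (card {r\<in>K A. \<not> T r c})) (real (card {r\<in>K A. T r c})))"
    using assms(2,6) \<mu> finK sep
    by (intro sum_mono separated_cluster_bound) (auto simp: K_def)
  also have "\<dots> = (\<Sum>A\<in>Pow J. \<Sum>c\<in>X. \<mu> c * real (min (w (a(i := c)) A) (w (a(i := c)) (insert i A))))"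
    by (intro sum.cong refl) (simp add: w0 w1 of_nat_min)
  also have "\<dots> = (\<Sum>c\<in>X. \<mu> c * (\<Sum>A\<in>Pow J. real (min (w (a(i := c)) A) (w (a(i := c)) (insert i A)))))"
    by (subst sum.swap) (simp add: sum_distrib_left)
  finally show ?thesis .
qed

text \<open>The mean total edge weight of the one-inclusion graph on \<open>s\<close> sampled
  columns is bounded twice: from below by treating each index in turn as the last one drawn, from
  above for every single sample by \<open>weighted_edge_bound\<close>.\<close>

lemma separated_sample_bound:
  fixes \<mu> :: "'c \<Rightarrow> real"
  assumes "finite R" "finite X" "\<And>c. c \<in> X \<Longrightarrow> \<mu> c \<ge> 0" "sum \<mu> X = 1" "\<delta> \<ge> 0"
    and vc: "vc_le T R X d"
    and "\<And>x y. x \<in> R \<Longrightarrow> y \<in> R \<Longrightarrow> x \<noteq> y \<Longrightarrow> (\<Sum>c\<in>{c\<in>X. T x c \<noteq> T y c}. \<mu> c) \<ge> \<delta>"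
  shows "real s * (\<delta> / 2 * (real (card R) - real s ^ d)) \<le> (real d + 1) * real (card R)"
proof -
  define I where "I = {..<s}"
  define w where "w a A = card {r \<in> R. pattern T I a r = A}" for a A
  define g where "g i a = (\<Sum>A\<in>Pow (I - {i}). real (min (w a A) (w a (insert i A))))" for i a
  have "finite I" by (simp add: I_def)
  have lower: "\<delta> / 2 * (real (card R) - real s ^ d) \<le> sample_mean \<mu> X I (g i)" if "i \<in> I" for i
  proof -
    have I: "insert i (I - {i}) = I" using that by auto
    have "card (I - {i}) + 1 = s" using that by (simp add: I_def)
    then have s: "real (card (I - {i})) + 1 = real s" by linarith
    have "\<delta> / 2 * (real (card R) - real s ^ d)
        = sample_mean \<mu> X (I - {i}) (\<lambda>_. \<delta> / 2 * (real (card R) - real s ^ d))"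
      using assms \<open>finite I\<close> by (simp add: sample_mean_const)
    also have "\<dots> \<le> sample_mean \<mu> X (I - {i}) (\<lambda>a. \<Sum>c\<in>X. \<mu> c * g i (a(i := c)))"
    proof (rule sample_mean_mono)
      fix a assume "a \<in> I - {i} \<rightarrow> X"
      then show "\<delta> / 2 * (real (card R) - real s ^ d) \<le> (\<Sum>c\<in>X. \<mu> c * g i (a(i := c)))"
        using new_coordinate_bound[of R X "I - {i}" i \<mu> \<delta> T d a] assms \<open>finite I\<close>
        unfolding I s g_def w_def by auto
    qed (use assms in auto)
    also have "\<dots> = sample_mean \<mu> X (insert i (I - {i})) (g i)"
      using \<open>finite I\<close> by (subst sample_mean_insert) auto
    finally show ?thesis unfolding I .
  qed
  have upper: "(\<Sum>i\<in>I. g i a) \<le> (real d + 1) * real (card R)" if a: "a \<in> I \<rightarrow> X" for a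
  proof -
    have supp: "{A. A \<subseteq> I \<and> w a A > 0} = pattern T I a ` R"
      using assms(1) by (auto simp: w_def card_gt_0_iff pattern_def)
    have "card R = card (\<Union>A\<in>Pow I. {r \<in> R. pattern T I a r = A})"
      by (rule arg_cong[where f = card]) (auto simp: pattern_def)
    also have "\<dots> = (\<Sum>A\<in>Pow I. w a A)"
      unfolding w_def using \<open>finite I\<close> assms(1) by (intro card_UN_disjoint) auto
    finally have R: "card R = (\<Sum>A\<in>Pow I. w a A)" .
    \<comment> \<open>The edge bound asks for a strict inequality on cardinalities, hence
      \<open>d + 1\<close>.\<close>
    have "(\<Sum>i\<in>I. \<Sum>A\<in>Pow (I - {i}). min (w a A) (w a (insert i A))) \<le> (d + 1) * card R"
      unfolding R using \<open>finite I\<close> card_shattered_patterns_le[OF vc a]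
      by (intro weighted_edge_bound) (auto simp: supp less_Suc_eq_le)
    then have "real (\<Sum>i\<in>I. \<Sum>A\<in>Pow (I - {i}). min (w a A) (w a (insert i A)))
        \<le> real ((d + 1) * card R)"
      by (rule of_nat_mono)
    then show ?thesis by (simp add: g_def algebra_simps)
  qed
  have "real s * (\<delta> / 2 * (real (card R) - real s ^ d))
      = (\<Sum>i\<in>I. \<delta> / 2 * (real (card R) - real s ^ d))"
    by (simp add: I_def)
  also have "\<dots> \<le> (\<Sum>i\<in>I. sample_mean \<mu> X I (g i))" by (intro sum_mono lower)
  also have "\<dots> = sample_mean \<mu> X I (\<lambda>a. \<Sum>i\<in>I. g i a)" by (rule sample_mean_sum[symmetric])
  also have "\<dots> \<le> sample_mean \<mu> X I (\<lambda>_. (real d + 1) * real (card R))"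
    using assms upper by (intro sample_mean_mono) auto
  also have "\<dots> = (real d + 1) * real (card R)"
    using assms \<open>finite I\<close> by (simp add: sample_mean_const)
  finally show ?thesis .
qed

text \<open>Choose \<open>s\<close> with \<open>s * \<delta> / 2 \<ge> 2 * (d + 1)\<close>. If
  \<open>n > s ^ d\<close>, then \<open>separated_sample_bound\<close> yields
  \<open>2 * (n - s ^ d) \<le> n\<close>, so \<open>n \<le> 2 * s ^ d\<close> in any case.\<close>

theorem Haussler_packing:
  fixes \<mu> :: "'c \<Rightarrow> real"
  assumes "finite R" "finite X" "\<And>c. c \<in> X \<Longrightarrow> \<mu> c \<ge> 0" "sum \<mu> X = 1" "0 < \<delta>" "\<delta> \<le> 1"
    and "vc_le T R X d"
    and "\<And>x y. x \<in> R \<Longrightarrow> y \<in> R \<Longrightarrow> x \<noteq> y \<Longrightarrow> (\<Sum>c\<in>{c\<in>X. T x c \<noteq> T y c}. \<mu> c) \<ge> \<delta>"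
  shows "real (card R) \<le> 2 * (8 * (real d + 1) / \<delta>) ^ d"
proof -
  define n where "n = real (card R)"
  define s where "s = nat \<lceil>4 * (real d + 1) / \<delta>\<rceil>"
  have ge: "4 * (real d + 1) / \<delta> \<ge> 1" using assms(5,6) by (simp add: field_simps)
  have s: "4 * (real d + 1) / \<delta> \<le> real s" "real s \<le> 4 * (real d + 1) / \<delta> + 1"
    using ge unfolding s_def by linarith+
  have "n \<le> 2 * real s ^ d"
  proof (rule ccontr)
    assume n: "\<not> n \<le> 2 * real s ^ d"
    then have "n - real s ^ d > n / 2" by simp
    moreover have "n / 2 > 0" using n by (smt (verit) zero_le_power of_nat_0_le_iff half_gt_zero)
    ultimately have pos: "n - real s ^ d > 0" by simp
    have "4 * (real d + 1) \<le> real s * \<delta>" using s(1) assms(5) by (simp add: field_simps)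
    have "(real d + 1) * (2 * (n - real s ^ d)) = 4 * (real d + 1) * ((n - real s ^ d) / 2)"
      by (simp add: field_simps)
    also have "\<dots> \<le> real s * \<delta> * ((n - real s ^ d) / 2)"
      using pos \<open>4 * (real d + 1) \<le> _\<close> by (intro mult_right_mono) auto
    also have "\<dots> \<le> (real d + 1) * n"
      using separated_sample_bound[of R X \<mu> \<delta> T d s] assms by (simp add: n_def)
    finally have "(real d + 1) * (2 * (n - real s ^ d)) \<le> (real d + 1) * n" .
    then have "2 * (n - real s ^ d) \<le> n" by (rule mult_left_le_imp_le) simp
    then show False using n by simp
  qed
  \<comment> \<open>As \<open>\<delta> \<le> 1\<close>, the number rounded up to \<open>s\<close> is
    at least \<open>1\<close>, so rounding costs at most a factor \<open>2\<close>.\<close>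
  also have "2 * real s ^ d \<le> 2 * (8 * (real d + 1) / \<delta>) ^ d"
  proof (intro mult_left_mono power_mono)
    have "8 * (real d + 1) / \<delta> = 2 * (4 * (real d + 1) / \<delta>)" by simp
    then show "real s \<le> 8 * (real d + 1) / \<delta>" using s(2) ge by linarith
  qed auto
  finally show ?thesis by (simp add: n_def)
qed

text \<open>Were all pairs farther apart, packing would apply to the normalized weights. The
  constant \<open>16\<close> turns its bound into
  \<open>2 * (n powr (1 / d) / 2) ^ d = 2 * n / 2 ^ d\<close>, which is at most \<open>n / 2\<close>
  for \<open>d \<ge> 2\<close>.\<close>

lemma close_pair_exists:
  fixes w :: "'c \<Rightarrow> real"
  assumes "finite R" "card R \<ge> 2" "finite X" "\<And>c. c \<in> X \<Longrightarrow> w c \<ge> 0"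
    and vc: "vc_le T R X d" and "d \<ge> 2"
  obtains x y where "x \<in> R" "y \<in> R" "x \<noteq> y"
    "(\<Sum>c\<in>{c\<in>X. T x c \<noteq> T y c}. w c)
      \<le> 16 * (real d + 1) * real (card R) powr (- (1 / real d)) * sum w X"
proof -
  define n where "n = real (card R)"
  define \<delta> where "\<delta> = 16 * (real d + 1) * n powr (- (1 / real d))"
  define W where "W = sum w X"
  have "n > 0" using assms(2) by (simp add: n_def)
  then have "\<delta> > 0" by (simp add: \<delta>_def)
  have "W \<ge> 0" unfolding W_def using assms(4) by (rule sum_nonneg)
  have "\<exists>x\<in>R. \<exists>y\<in>R. x \<noteq> y \<and> (\<Sum>c\<in>{c\<in>X. T x c \<noteq> T y c}. w c) \<le> \<delta> * W"
  proof (rule ccontr)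
    assume "\<not> ?thesis"
    then have far: "(\<Sum>c\<in>{c\<in>X. T x c \<noteq> T y c}. w c) > \<delta> * W"
      if "x \<in> R" "y \<in> R" "x \<noteq> y" for x y
      using that not_le by blast
    obtain x y where xy: "x \<in> R" "y \<in> R" "x \<noteq> y"
      using assms(1,2) by (metis card_2_iff' obtain_subset_with_card_n subset_iff)
    have "(\<Sum>c\<in>{c\<in>X. T x c \<noteq> T y c}. w c) \<le> W"
      unfolding W_def using assms(3,4) by (intro sum_mono2) auto
    \<comment> \<open>No two rows are farther apart than the total weight, so a separated pair rules
      out both \<open>W = 0\<close> and \<open>\<delta> > 1\<close>.\<close>
    then have lt: "\<delta> * W < W" using far[OF xy] by simp
    then have "W > 0" using \<open>W \<ge> 0\<close> by (cases "W = 0") auto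
    then have "\<delta> \<le> 1" using lt by simp
    have "n \<le> 2 * (8 * (real d + 1) / \<delta>) ^ d"
      unfolding n_def
    proof (rule Haussler_packing[where \<mu> = "\<lambda>c. w c / W"])
      show "(\<Sum>c\<in>X. w c / W) = 1"
        using \<open>W > 0\<close> by (simp add: W_def flip: sum_divide_distrib)
      show "\<delta> \<le> (\<Sum>c\<in>{c\<in>X. T x c \<noteq> T y c}. w c / W)" if "x \<in> R" "y \<in> R" "x \<noteq> y" for x y
        using far[OF that] \<open>W > 0\<close> by (simp add: field_simps flip: sum_divide_distrib)
    qed (use assms \<open>W > 0\<close> \<open>\<delta> > 0\<close> \<open>\<delta> \<le> 1\<close> in auto)
    also have "8 * (real d + 1) / \<delta> = n powr (1 / real d) / 2"
      using \<open>n > 0\<close> by (simp add: \<delta>_def powr_minus field_simps)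
    also have "2 * (n powr (1 / real d) / 2) ^ d = 2 * n / 2 ^ d"
      using \<open>n > 0\<close> \<open>d \<ge> 2\<close> by (simp add: power_divide powr_powr flip: powr_realpow)
    also have "\<dots> \<le> 2 * n / 2 ^ 2"
      using \<open>n > 0\<close> \<open>d \<ge> 2\<close> by (intro divide_left_mono power_increasing) auto
    finally show False using \<open>n > 0\<close> by simp
  qed
  then show ?thesis using that unfolding \<delta>_def W_def n_def by blast
qed

section \<open>Orders with few sign changes\<close>

fun changes :: "('a \<Rightarrow> bool) \<Rightarrow> 'a list \<Rightarrow> nat" where
  "changes f [] = 0"
| "changes f [x] = 0"
| "changes f (x # y # ys) = of_bool (f x \<noteq> f y) + changes f (y # ys)"

text \<open>If \<open>x\<close> agrees with \<open>y\<close>, it merely repeats the value of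
  \<open>y\<close>. Otherwise only the neighbours \<open>y\<close>, \<open>x\<close> and
  \<open>x\<close>, \<open>hd vs\<close> can create changes.\<close>

lemma changes_insert_after:
  "changes f (us @ y # x # vs) \<le> changes f (us @ y # vs) + 2 * of_bool (f x \<noteq> f y)"
proof (induction us rule: induct_list012)
  case 1
  then show ?case by (cases vs) auto
next
  case (2 u)
  then show ?case by (cases vs) auto
next
  case (3 u u' us)
  then show ?case by simp
qed

text \<open>Welzl's reweighting. Multiplying the weight of the columns that separate \<open>x\<close> and \<open>y\<close> by \<open>4\<close>
  pays for the at most two sign changes created when \<open>x\<close> is put next to \<open>y\<close>.\<close>

lemma low_crossing_order:
  fixes w :: "'c \<Rightarrow> real"
  assumes "finite R" "R \<noteq> {}" "finite X" "\<And>c. c \<in> X \<Longrightarrow> w c \<ge> 0" "vc_le T R X d" "d \<ge> 2"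
  shows "\<exists>xs. set xs = R \<and> (\<Sum>c\<in>X. w c * 2 ^ changes (\<lambda>r. T r c) xs)
    \<le> sum w X * (\<Prod>i=2..card R. 1 + 48 * (real d + 1) * real i powr (- (1 / real d)))"
  using assms
proof (induction "card R - 1" arbitrary: R w)
  case 0
  then have "card R = 1" using card_gt_0_iff[of R] by linarith
  then obtain r where "R = {r}" by (auto simp: card_1_singleton_iff)
  then show ?case by (intro exI[of _ "[r]"]) simp
next
  case (Suc m)
  define \<epsilon> where "\<epsilon> = 16 * (real d + 1) * real (card R) powr (- (1 / real d))"
  let ?g = "\<lambda>i::nat. 1 + 48 * (real d + 1) * real i powr (- (1 / real d))"
  have card: "card R = Suc (Suc m)" using Suc.hyps(2) by linarith
  then have "card R \<ge> 2" by simp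
  obtain x y where xy: "x \<in> R" "y \<in> R" "x \<noteq> y"
    and close: "(\<Sum>c\<in>{c\<in>X. T x c \<noteq> T y c}. w c) \<le> \<epsilon> * sum w X"
    unfolding \<epsilon>_def
    by (rule close_pair_exists[OF Suc.prems(1) \<open>card R \<ge> 2\<close> Suc.prems(3), of w T d])
       (use Suc.prems in auto)
  define w' where "w' c = w c * 4 ^ of_bool (T x c \<noteq> T y c)" for c
  have card': "card (R - {x}) = Suc m" using xy card Suc.prems(1) by simp
  \<comment> \<open>The remaining rows are ordered for the increased weights; \<open>y\<close> is
    among them, so \<open>x\<close> can be put right after it.\<close>
  have "\<exists>xs. set xs = R - {x} \<and> (\<Sum>c\<in>X. w' c * 2 ^ changes (\<lambda>r. T r c) xs)
      \<le> sum w' X * (\<Prod>i=2..card (R - {x}). ?g i)"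
    using Suc.prems xy card' vc_le_subset[OF Suc.prems(5), of "R - {x}"]
    by (intro Suc.hyps(1)) (auto simp: w'_def)
  then obtain xs where xs: "set xs = R - {x}" and le: "(\<Sum>c\<in>X. w' c * 2 ^ changes (\<lambda>r. T r c) xs)
      \<le> sum w' X * (\<Prod>i=2..Suc m. ?g i)"
    unfolding card' by blast
  obtain us vs where split: "xs = us @ y # vs"
    using xs xy by (metis Diff_iff singletonD split_list)
  define ys where "ys = us @ y # x # vs"
  have "set ys = R" using xs xy split by (auto simp: ys_def)
  have "(\<Sum>c\<in>X. w c * 2 ^ changes (\<lambda>r. T r c) ys) \<le> (\<Sum>c\<in>X. w' c * 2 ^ changes (\<lambda>r. T r c) xs)"
  proof (rule sum_mono)
    fix c assume c: "c \<in> X"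
    have "(2::real) ^ changes (\<lambda>r. T r c) ys
        \<le> 2 ^ (changes (\<lambda>r. T r c) xs + 2 * of_bool (T x c \<noteq> T y c))"
      unfolding ys_def split by (intro power_increasing changes_insert_after) auto
    also have "\<dots> = 4 ^ of_bool (T x c \<noteq> T y c) * 2 ^ changes (\<lambda>r. T r c) xs"
      by (simp add: power_add power_mult)
    finally show "w c * 2 ^ changes (\<lambda>r. T r c) ys \<le> w' c * 2 ^ changes (\<lambda>r. T r c) xs"
      using Suc.prems(4)[OF c] by (simp add: w'_def mult_left_mono mult.assoc)
  qed
  also note le
  \<comment> \<open>Reweighting adds three more copies of the separated weight, which is at most
    \<open>\<epsilon> * sum w X\<close>. The total grows by a factor of at most
    \<open>1 + 3 * \<epsilon>\<close>, whence the \<open>48\<close>.\<close>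
  also have "sum w' X * (\<Prod>i=2..Suc m. ?g i) \<le> (sum w X * ?g (card R)) * (\<Prod>i=2..Suc m. ?g i)"
  proof (intro mult_right_mono prod_nonneg)
    have "sum w' X = (\<Sum>c\<in>X. w c + 3 * (w c * of_bool (T x c \<noteq> T y c)))"
      by (rule sum.cong) (auto simp: w'_def)
    also have "\<dots> = sum w X + 3 * (\<Sum>c\<in>X. w c * of_bool (T x c \<noteq> T y c))"
      by (simp add: sum.distrib sum_distrib_left)
    also have "(\<Sum>c\<in>X. w c * of_bool (T x c \<noteq> T y c)) = (\<Sum>c\<in>{c\<in>X. T x c \<noteq> T y c}. w c)"
      using Suc.prems(3) by (simp add: of_bool_def if_distrib sum.If_cases Int_def cong: if_cong)
    finally show "sum w' X \<le> sum w X * ?g (card R)"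
      using close by (simp add: \<epsilon>_def algebra_simps)
  qed (auto intro!: add_nonneg_nonneg)
  also have "\<dots> = sum w X * (\<Prod>i=2..card R. ?g i)"
    by (simp add: card mult_ac)
  finally show ?case using \<open>set ys = R\<close> by blast
qed

section \<open>Growth of the total weight\<close>

text \<open>The constant \<open>2\<close> dominates the factor \<open>1 / (1 - \<beta>)\<close>
  known from integration. The inductive step rests on \<open>(1 - 1 / m) powr (1 - \<beta>) \<le>
  sqrt (1 - 1 / m) \<le> 1 - 1 / (2 * m)\<close>.\<close>

lemma sum_powr_minus_le:
  fixes \<beta> :: real
  assumes "n \<ge> 1" "\<beta> \<le> 1 / 2"
  shows "(\<Sum>i=2..n. real i powr (- \<beta>)) \<le> 2 * real n powr (1 - \<beta>)"
  using assms(1)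
proof (induction n rule: nat_induct_at_least)
  case base
  then show ?case by simp
next
  case (Suc n)
  define m where "m = real (Suc n)"
  have m: "m > 1" "real n = m - 1" using Suc by (auto simp: m_def)
  have "(1 - 1 / m) powr (1 - \<beta>) \<le> (1 - 1 / m) powr (1 / 2)"
    using m assms(2) by (intro powr_mono') auto
  also have "\<dots> = sqrt (1 - 1 / m)" using m by (simp add: powr_half_sqrt)
  also have "\<dots> \<le> 1 - 1 / (2 * m)"
    using m by (intro real_le_lsqrt) (auto simp: field_simps power2_eq_square)
  finally have "m powr (1 - \<beta>) * (1 - 1 / m) powr (1 - \<beta>) \<le> m powr (1 - \<beta>) * (1 - 1 / (2 * m))"
    by (intro mult_left_mono) auto
  moreover have "m powr (1 - \<beta>) * (1 - 1 / m) powr (1 - \<beta>) = real n powr (1 - \<beta>)"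
  proof -
    have "m * (1 - 1 / m) = real n" using m by (simp add: right_diff_distrib)
    then show ?thesis using m powr_mult[of m "1 - 1 / m" "1 - \<beta>"] by simp
  qed
  moreover have "m powr (- \<beta>) = m powr (1 - \<beta>) / m"
    using m powr_diff[of m "1 - \<beta>" 1] by simp
  ultimately have "2 * real n powr (1 - \<beta>) + m powr (- \<beta>) \<le> 2 * m powr (1 - \<beta>)"
    by (simp add: algebra_simps)
  moreover have "(\<Sum>i=2..Suc n. real i powr (- \<beta>)) = (\<Sum>i=2..n. real i powr (- \<beta>)) + m powr (- \<beta>)"
    using Suc by (simp add: m_def)
  ultimately show ?case using Suc.IH by (simp add: m_def)
qed

text \<open>With unit weights, \<open>2 ^ changes\<close> for one column is at most the whole sum,
  hence at most \<open>n\<close> times the reweighting product. By \<open>1 + z \<le> exp z\<close>,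
  logarithms turn the product into a sum of powers of \<open>i\<close>, of order
  \<open>n powr \<alpha>\<close>.\<close>

theorem Welzl_order:
  assumes "finite R" "finite X" "vc_le T R X d" "d \<ge> 2" "R \<noteq> {}" "card X \<le> card R"
  shows "\<exists>xs. set xs = R \<and> (\<forall>c\<in>X. real (changes (\<lambda>r. T r c) xs)
    \<le> (196 + 192 * real d) * real (card R) powr (1 - 1 / real d))"
proof -
  define n where "n = card R"
  define \<alpha> where "\<alpha> = 1 - 1 / real d"
  have n: "n \<ge> 1" using assms by (simp add: n_def Suc_leI card_gt_0_iff)
  have \<alpha>: "\<alpha> \<ge> 1 / 2" using assms(4) by (simp add: \<alpha>_def field_simps)
  let ?g = "\<lambda>i::nat. 1 + 48 * (real d + 1) * real i powr (- (1 / real d))"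
  obtain xs where xs: "set xs = R" and le: "(\<Sum>c\<in>X. 1 * 2 ^ changes (\<lambda>r. T r c) xs)
      \<le> (\<Sum>c\<in>X. 1) * (\<Prod>i=2..n. ?g i)"
    using low_crossing_order[of R X "\<lambda>_. 1" T d] assms unfolding n_def by auto
  have "(\<Prod>i=2..n. ?g i) \<le> (\<Prod>i=2..n. exp (48 * (real d + 1) * real i powr (- (1 / real d))))"
    by (intro prod_mono conjI exp_ge_add_one_self add_nonneg_nonneg) auto
  also have "\<dots> = exp (48 * (real d + 1) * (\<Sum>i=2..n. real i powr (- (1 / real d))))"
    by (simp add: exp_sum sum_distrib_left)
  also have "\<dots> \<le> exp (48 * (real d + 1) * (2 * real n powr \<alpha>))"
    unfolding \<alpha>_def exp_le_cancel_iff
    using n assms(4) by (intro mult_left_mono sum_powr_minus_le) (auto simp: field_simps)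
  finally have prod: "(\<Prod>i=2..n. ?g i) \<le> exp (48 * (real d + 1) * (2 * real n powr \<alpha>))" .
  \<comment> \<open>The factor \<open>n\<close> costs \<open>ln n\<close>, which is absorbed because
    \<open>\<alpha> \<ge> 1 / 2\<close>.\<close>
  have "ln (real n) \<le> 2 * real n powr \<alpha>"
  proof -
    have "ln (real n) = 2 * ln (sqrt (real n))" using n by (simp add: ln_sqrt)
    also have "\<dots> \<le> 2 * sqrt (real n)" using n ln_le_minus_one[of "sqrt (real n)"] by simp
    also have "\<dots> = 2 * real n powr (1 / 2)" by (simp add: powr_half_sqrt)
    also have "\<dots> \<le> 2 * real n powr \<alpha>" using n \<alpha> by (intro mult_left_mono powr_mono) auto
    finally show ?thesis .
  qed
  have "real (changes (\<lambda>r. T r c) xs) \<le> (196 + 192 * real d) * real n powr \<alpha>" if "c \<in> X" for c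
  proof -
    let ?k = "changes (\<lambda>r. T r c) xs"
    have "2 ^ ?k \<le> (\<Sum>c\<in>X. 1 * 2 ^ changes (\<lambda>r. T r c) xs :: real)"
      using member_le_sum[of c X "\<lambda>c. 2 ^ changes (\<lambda>r. T r c) xs :: real"] that assms(2) by simp
    also note le
    also have "(\<Sum>c\<in>X. 1) * (\<Prod>i=2..n. ?g i) \<le> real n * exp (48 * (real d + 1) * (2 * real n powr \<alpha>))"
      using assms(6) prod by (intro mult_mono prod_nonneg) (auto simp: n_def intro!: add_nonneg_nonneg)
    finally have "ln (2 ^ ?k) \<le> ln (real n * exp (48 * (real d + 1) * (2 * real n powr \<alpha>)))"
      using n by (subst ln_le_cancel_iff) auto
    also have "\<dots> = ln (real n) + 48 * (real d + 1) * (2 * real n powr \<alpha>)"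
      using n by (simp add: ln_mult)
    also have "\<dots> \<le> 2 * real n powr \<alpha> + 48 * (real d + 1) * (2 * real n powr \<alpha>)"
      using \<open>ln (real n) \<le> _\<close> by simp
    finally have "real ?k * ln 2 \<le> (98 + 96 * real d) * real n powr \<alpha>"
      by (simp add: ln_realpow algebra_simps)
    \<comment> \<open>\<open>ln 2 \<ge> 1 / 2\<close> doubles \<open>98 + 96 * d\<close> to the
      stated constant.\<close>
    moreover have "real ?k * (1 / 2) \<le> real ?k * ln 2"
      using ln_le_minus_one[of "1 / 2 :: real"] by (intro mult_left_mono) (auto simp: ln_div)
    ultimately show ?thesis by (simp add: algebra_simps)
  qed
  then show ?thesis using xs by (auto simp: n_def \<alpha>_def)
qed

section \<open>Sign rank\<close>

text \<open>In the reversed list a new head becomes the last evaluation point \<open>n\<close>; if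
  the sign must change there, a linear factor with root \<open>n - 1 / 2\<close> flips it from
  \<open>n\<close> on. The last conjunct records the sign of \<open>q\<close> beyond its final
  point, which the induction uses at the new point.\<close>

lemma sign_polynomial:
  assumes "xs \<noteq> []"
  shows "\<exists>q::real poly. degree q \<le> changes f xs \<and>
    (\<forall>k<length xs. sgn (poly q (real k)) = (if f (rev xs ! k) then 1 else -1)) \<and>
    (\<forall>k\<ge>length xs - 1. sgn (poly q (real k)) = (if f (hd xs) then 1 else -1))"
  using assms
proof (induction f xs rule: changes.induct)
  case (1 f)
  then show ?case by simp
next
  case (2 f x)
  then show ?case by (intro exI[of _ "[:if f x then 1 else -1:]"]) auto
next
  case (3 f x y ys)
  define n where "n = length (y # ys)"
  obtain q :: "real poly" where q: "degree q \<le> changes f (y # ys)"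
    "\<And>k. k < n \<Longrightarrow> sgn (poly q (real k)) = (if f (rev (y # ys) ! k) then 1 else -1)"
    "\<And>k. k \<ge> n - 1 \<Longrightarrow> sgn (poly q (real k)) = (if f y then 1 else -1)"
    using 3 unfolding n_def by auto
  define p where "p = (if f x = f y then q else q * [:real n - 1 / 2, -1:])"
  have poly_p: "poly p (real k) =
      (if f x = f y then poly q (real k) else poly q (real k) * (real n - 1 / 2 - real k))" for k
    by (simp add: p_def algebra_simps)
  have "degree p \<le> changes f (x # y # ys)"
    using q(1) degree_mult_le[of q "[:real n - 1 / 2, -1:]"] by (auto simp: p_def)
  moreover have high: "sgn (poly p (real k)) = (if f x then 1 else -1)" if "k \<ge> n" for k
  proof -
    have "sgn (real n - 1 / 2 - real k) = -1" using that by simp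
    then show ?thesis using that q(3)[of k] by (auto simp: poly_p sgn_mult)
  qed
  moreover have low: "sgn (poly p (real k)) = (if f (rev (y # ys) ! k) then 1 else -1)" if "k < n" for k
  proof -
    have "sgn (real n - 1 / 2 - real k) = 1" using that by simp
    then show ?thesis using q(2)[OF that] by (simp add: poly_p sgn_mult)
  qed
  moreover have "sgn (poly p (real k)) = (if f (rev (x # y # ys) ! k) then 1 else -1)"
    if "k < length (x # y # ys)" for k
  proof (cases "k < n")
    case True
    then have "rev (x # y # ys) ! k = rev (y # ys) ! k"
      using nth_append[of "rev (y # ys)" "[x]" k] by (simp add: n_def)
    then show ?thesis using low[OF True] by simp
  next
    case False
    then have "k = n" using that by (simp add: n_def)
    then have "rev (x # y # ys) ! k = x"
      using nth_append[of "rev (y # ys)" "[x]" k] by (simp add: n_def)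
    then show ?thesis using high[of k] \<open>k = n\<close> by simp
  qed
  ultimately show ?case by (intro exI[of _ p]) (auto simp: n_def)
qed

text \<open>Each \<open>k\<close> contributes an outer product of rank at most one, and rank is
  subadditive.\<close>

lemma rank_sum_of_products_le:
  fixes a :: "nat \<Rightarrow> nat \<Rightarrow> 'a::field"
  shows "vec_space.rank n (mat n m (\<lambda>(i, j). \<Sum>k<t. a i k * b k j)) \<le> t"
proof (induction t)
  case 0
  have "mat n m (\<lambda>(i, j). \<Sum>k<0. a i k * b k j) = 0\<^sub>m n m" by (intro eq_matI) auto
  then show ?case using vec_space.rank_0I[of n m] by (metis le_refl)
next
  case (Suc t)
  let ?A = "mat n m (\<lambda>(i, j). \<Sum>k<t. a i k * b k j)"
  let ?B = "mat n m (\<lambda>(i, j). a i t * b t j)"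
  have "mat n m (\<lambda>(i, j). \<Sum>k<Suc t. a i k * b k j) = ?A + ?B"
    by (intro eq_matI) auto
  moreover have "vec_space.rank n (?A + ?B) \<le> vec_space.rank n ?A + vec_space.rank n ?B"
    by (rule vec_space.rank_subadditive[where nc = m]) auto
  moreover have "vec_space.rank n ?B \<le> 1"
    by (rule vec_space.rank_le_1_product_entries[where nc = m and f = "\<lambda>i. a i t" and g = "\<lambda>j. b t j"]) auto
  ultimately show ?case using Suc by simp
qed

text \<open>Each column of the witness is a polynomial of degree at most \<open>t\<close> in the row
  position. The matrix thus factors into a Vandermonde matrix with \<open>t + 1\<close> columns and
  a coefficient matrix.\<close>

lemma sign_rank_le_changes:
  assumes S: "S \<in> carrier_mat N M" "sign_matrix S" and xs: "set xs = {..<N}" "N > 0"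
    and t: "\<And>j. j < M \<Longrightarrow> changes (\<lambda>i. S $$ (i, j) = 1) xs \<le> t"
  shows "sign_rank S \<le> t + 1"
proof -
  have ent: "S $$ (i, j) = 1 \<or> S $$ (i, j) = -1" if "i < N" "j < M" for i j
    using S(2) carrier_matD[OF S(1)] that unfolding sign_matrix_def by blast
  have "0 \<in> set xs" using xs by simp
  then have "xs \<noteq> []" by (cases xs) simp_all
  obtain q :: "nat \<Rightarrow> real poly" where q: "\<And>j. degree (q j) \<le> changes (\<lambda>i. S $$ (i, j) = 1) xs"
    "\<And>j k. k < length xs \<Longrightarrow> sgn (poly (q j) (real k)) = (if S $$ (rev xs ! k, j) = 1 then 1 else -1)"
  proof -
    have "\<forall>j. \<exists>q::real poly. degree q \<le> changes (\<lambda>i. S $$ (i, j) = 1) xs \<and>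
      (\<forall>k<length xs. sgn (poly q (real k)) = (if S $$ (rev xs ! k, j) = 1 then 1 else -1))"
      using sign_polynomial[OF \<open>xs \<noteq> []\<close>] by blast
    from choice[OF this] show thesis using that by blast
  qed
  \<comment> \<open>Should a row occur several times in \<open>xs\<close>, any of its positions will
    do: \<open>q j\<close> has the right sign at each.\<close>
  have "\<exists>k<length xs. rev xs ! k = i" if "i < N" for i
    using that xs in_set_conv_nth[of i "rev xs"] by auto
  then obtain pos where pos: "\<And>i. i < N \<Longrightarrow> pos i < length xs \<and> rev xs ! pos i = i" by metis
  define A where "A = mat N M (\<lambda>(i, j). \<Sum>k<t + 1. real (pos i) ^ k * coeff (q j) k)"
  have A: "A $$ (i, j) = poly (q j) (real (pos i))" if "i < N" "j < M" for i j
  proof -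
    have "degree (q j) \<le> t" using q(1)[of j] t[of j] that by linarith
    then have "poly (q j) (real (pos i)) = (\<Sum>k\<le>t. coeff (q j) k * real (pos i) ^ k)"
      unfolding poly_altdef by (intro sum.mono_neutral_left) (auto simp: coeff_eq_0)
    then show ?thesis using that by (simp add: A_def lessThan_Suc_atMost mult.commute)
  qed
  have sgn: "sgn (A $$ (i, j)) = S $$ (i, j)" if "i < N" "j < M" for i j
    using A[OF that] q(2)[of "pos i" j] pos[OF that(1)] ent[OF that] by auto
  have "A $$ (i, j) \<noteq> 0" if "i < N" "j < M" for i j
    using sgn[OF that] ent[OF that] by auto
  moreover have "map_mat sgn A = S"
    using S sgn by (intro eq_matI) (auto simp: A_def)
  ultimately have "sign_rank S \<le> vec_space.rank N A"
    unfolding sign_rank_def using S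
    by (intro Least_le bexI[of _ A]) (auto simp: A_def)
  also have "\<dots> \<le> t + 1" unfolding A_def by (rule rank_sum_of_products_le)
  finally show ?thesis .
qed

section \<open>VC dimension of a sign matrix and the final bound\<close>

text \<open>A subset \<open>B\<close> of \<open>C\<close> corresponds to the sign pattern that is
  \<open>1\<close> exactly on \<open>B\<close>. Shattered sets are bounded in size by the number of
  columns, so \<open>Sup\<close> is an upper bound.\<close>

lemma vc_le_VC_dim:
  assumes "S \<in> carrier_mat N M" "sign_matrix S"
  shows "vc_le (\<lambda>i j. S $$ (i, j) = 1) {..<N} {..<M} (VC_dim S)"
  unfolding vc_le_def
proof (intro allI impI)
  fix C assume C: "C \<subseteq> {..<M}" "\<forall>B\<subseteq>C. \<exists>i\<in>{..<N}. {j \<in> C. S $$ (i, j) = 1} = B"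
  have "shattered S C"
    unfolding shattered_def
  proof (intro conjI ballI)
    show "C \<subseteq> {..<dim_col S}" using C assms by auto
    fix p :: "nat \<Rightarrow> real" assume p: "p \<in> C \<rightarrow> {-1, 1}"
    obtain i where i: "i < N" "{j \<in> C. S $$ (i, j) = 1} = {j \<in> C. p j = 1}"
      using C(2)[rule_format, of "{j \<in> C. p j = 1}"] by auto
    have "S $$ (i, j) = p j" if "j \<in> C" for j
    proof -
      have "S $$ (i, j) \<in> {-1, 1}" using assms i(1) that C(1) by (auto simp: sign_matrix_def)
      moreover have "p j \<in> {-1, 1}" using p that by blast
      moreover have "S $$ (i, j) = 1 \<longleftrightarrow> p j = 1" using i(2) that by blast
      ultimately show ?thesis by auto
    qed
    then show "\<exists>i<dim_row S. \<forall>j\<in>C. S $$ (i, j) = p j" using i(1) assms by auto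
  qed
  moreover have "bdd_above {card C | C. shattered S C}"
  proof (rule bdd_aboveI)
    fix k assume "k \<in> {card C | C. shattered S C}"
    then show "k \<le> dim_col S"
      using card_mono[of "{..<dim_col S}"] by (auto simp: shattered_def)
  qed
  ultimately show "card C \<le> VC_dim S"
    unfolding VC_dim_def by (intro cSup_upper) auto
qed

text \<open>Without rows not even \<open>{}\<close> is shattered, and \<open>Sup {} = 0\<close> on
  the naturals. It serves to derive \<open>N > 0\<close> from VC dimension at least
  \<open>2\<close>.\<close>

lemma VC_dim_no_rows: "dim_row S = 0 \<Longrightarrow> VC_dim S = 0"
proof -
  assume "dim_row S = 0"
  then have "\<not> shattered S C" for C
    unfolding shattered_def by (metis insertCI not_less_zero Pi_I)
  then show ?thesis by (simp add: VC_dim_def)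
qed

theorem sign_rank_le:
  assumes S: "S \<in> carrier_mat N N" "sign_matrix S" and "VC_dim S \<ge> 2"
  defines "d \<equiv> VC_dim S"
  shows "real (sign_rank S) \<le> (197 + 192 * real d) * real N powr (1 - 1 / real d)"
proof -
  define B where "B = (196 + 192 * real d) * real N powr (1 - 1 / real d)"
  have "N > 0" using assms VC_dim_no_rows[of S] by (cases N) auto
  have "\<exists>xs. set xs = {..<N} \<and>
      (\<forall>j\<in>{..<N}. real (changes (\<lambda>i. S $$ (i, j) = 1) xs) \<le> B)"
    using Welzl_order[of "{..<N}" "{..<N}" "\<lambda>i j. S $$ (i, j) = 1" d]
      vc_le_VC_dim[OF S] assms \<open>N > 0\<close> by (auto simp: B_def)
  then obtain xs where xs: "set xs = {..<N}"
    and ch: "\<And>j. j < N \<Longrightarrow> real (changes (\<lambda>i. S $$ (i, j) = 1) xs) \<le> B" by blast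
  have "changes (\<lambda>i. S $$ (i, j) = 1) xs \<le> nat \<lfloor>B\<rfloor>" if "j < N" for j
    using ch[OF that] by linarith
  then have "sign_rank S \<le> nat \<lfloor>B\<rfloor> + 1"
    by (rule sign_rank_le_changes[OF S xs \<open>N > 0\<close>])
  moreover have "B \<ge> 0" by (simp add: B_def)
  ultimately have "real (sign_rank S) \<le> B + 1" by linarith
  \<comment> \<open>The \<open>1\<close> that the rank exceeds the degree by is absorbed into the
    power of \<open>N\<close>, raising \<open>196\<close> to \<open>197\<close>.\<close>
  moreover have "1 \<le> real N powr (1 - 1 / real d)"
    using \<open>N > 0\<close> assms by (intro ge_one_powr_ge_zero) (auto simp: d_def field_simps)
  ultimately show ?thesis by (simp add: B_def algebra_simps)
qed

theorem theorem7:
  fixes d :: nat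
  assumes "d \<ge> 2"
  shows "(\<exists>C::real. \<forall>N. \<forall>S \<in> carrier_mat N N. sign_matrix S \<and> VC_dim S = d \<longrightarrow>
            real (sign_rank S) \<le> C * real N powr (1 - 1 / real d)) \<and>
         (\<lambda>N. real (max_sign_rank N d)) \<in> O(\<lambda>N. real N powr (1 - 1 / real d))"
proof
  let ?C = "197 + 192 * real d"
  show "\<exists>C::real. \<forall>N. \<forall>S \<in> carrier_mat N N. sign_matrix S \<and> VC_dim S = d \<longrightarrow>
            real (sign_rank S) \<le> C * real N powr (1 - 1 / real d)"
    using sign_rank_le assms by (intro exI[of _ ?C]) auto
  have "real (max_sign_rank N d) \<le> ?C * real N powr (1 - 1 / real d)" for N
  proof -
    define F where "F = {sign_rank S | S. S \<in> carrier_mat N N \<and> sign_matrix S \<and> VC_dim S = d}"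
    have B: "0 \<le> ?C * real N powr (1 - 1 / real d)" by simp
    \<comment> \<open>\<open>Sup\<close> is taken in the naturals, so the real bound is rounded down
      first; for empty \<open>F\<close> it is \<open>0\<close>.\<close>
    have "Sup F \<le> nat \<lfloor>?C * real N powr (1 - 1 / real d)\<rfloor>"
    proof (cases "F = {}")
      case False
      then show ?thesis
      proof (rule cSup_least)
        fix r assume "r \<in> F"
        then have "real r \<le> ?C * real N powr (1 - 1 / real d)"
          using sign_rank_le assms unfolding F_def by blast
        then show "r \<le> nat \<lfloor>?C * real N powr (1 - 1 / real d)\<rfloor>" by linarith
      qed
    qed simp
    then show ?thesis using B unfolding max_sign_rank_def F_def by linarith
  qed
  then show "(\<lambda>N. real (max_sign_rank N d)) \<in> O(\<lambda>N. real N powr (1 - 1 / real d))"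
    by (intro bigoI[of _ ?C]) simp
qed

end
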